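(* Let $\lambda\in(0,\infty)$. For every positive integer $n$ and every real $s>(n+1)\lambda$ we have $$\mathcal{L}_{\lambda}(t^n)=\frac{n!}{(s-\lambda)(s-2\lambda)\cdots(s-n\lambda)(s-(n+1)\lambda)}=\frac{n!}{s^{n+1}}\cdot\frac{1}{\left(1-\frac{\lambda}{s}\right)\left(1-\frac{2\lambda}{s}\right)\cdots\left(1-\frac{(n+1)\lambda}{s}\right)}.$$ Moreover, $$\mathcal{L}_{\lambda}(t^n)=\frac{1}{s^{n+1}}\,\Gamma_{\frac{\lambda}{s}}(n+1).$$
   Context: For $\lambda\in(0,\infty)$ and a function $f(t)$ defined for $t\ge 0$, the degenerate Laplace transform of $f$ is the function of $s$ given by $$\mathcal{L}_{\lambda}(f(t))=\int_0^{\infty}(1+\lambda t)^{-\frac{s}{\lambda}}f(t)\,dt,$$ provided the integral converges. For real $\mu\in(0,\infty)$ and complex $z$ with $0<\operatorname{Re}(z)<\frac1\mu$, the degenerate gamma function is defined by $$\Gamma_{\mu}(z)=\int_0^{\infty}(1+\mu t)^{-\frac1\mu}\,t^{z-1}\,dt .$$ *)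

theory Defs
  imports "HOL-Analysis.Analysis"
begin

text \<open>
  Integrals over the half-line are Henstock--Kurzweil integrals over \<open>{0..}\<close>. By Hake's theorem
  they agree with improper integrals, so conditionally convergent ones are included.
  The complex powers have a positive real base, hence \<open>powr\<close> is the usual principal power
  (except at \<open>t = 0\<close> in the gamma integrand, a null set).
\<close>

definition degenerate_laplace_integrand :: "real \<Rightarrow> (real \<Rightarrow> complex) \<Rightarrow> complex \<Rightarrow> real \<Rightarrow> complex" where
  "degenerate_laplace_integrand lam f s t =
     complex_of_real (1 + lam * t) powr (- (s / complex_of_real lam)) * f t"

definition degenerate_laplace_converges :: "real \<Rightarrow> (real \<Rightarrow> complex) \<Rightarrow> complex \<Rightarrow> bool" where
  "degenerate_laplace_converges lam f s \<longleftrightarrow> degenerate_laplace_integrand lam f s integrable_on {0..}"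

text \<open>Meaningful for \<open>lam > 0\<close> and \<^const>\<open>degenerate_laplace_converges\<close>; a divergent integral
  gets the library's default value \<open>0\<close>.\<close>

definition degenerate_laplace :: "real \<Rightarrow> (real \<Rightarrow> complex) \<Rightarrow> complex \<Rightarrow> complex" where
  "degenerate_laplace lam f s = integral {0..} (degenerate_laplace_integrand lam f s)"

text \<open>Meaningful for \<open>\<mu> > 0\<close> and \<open>0 < Re z < 1 / \<mu>\<close>.\<close>

definition degenerate_Gamma :: "real \<Rightarrow> complex \<Rightarrow> complex" where
  "degenerate_Gamma \<mu> z =
     integral {0..} (\<lambda>t. complex_of_real ((1 + \<mu> * t) powr (- (1 / \<mu>)))
                         * complex_of_real t powr (z - 1))"

end

theory Submission
  imports Defs
begin

text \<open>
  Integration by parts, with \<open>(1 + \<lambda> t) powr (1 - s / \<lambda>)\<close> as an antiderivative of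
  \<open>(\<lambda> - s) (1 + \<lambda> t) powr (- s / \<lambda>)\<close>, trades one power of \<open>t\<close> for a shift of \<open>s\<close> by \<open>\<lambda>\<close>:
  \<open>(s - \<lambda>) L(t ^ (n + 1))(s) = (n + 1) L(t ^ n)(s - \<lambda>)\<close>.
  The boundary term vanishes at infinity because \<open>s > (n + 2) \<lambda>\<close>, and this hypothesis for
  \<open>(n + 1, s)\<close> is exactly the one needed for \<open>(n, s - \<lambda>)\<close>. Iterating gives
  \<open>n! / ((s - \<lambda>) \<cdots> (s - (n + 1) \<lambda>))\<close>.

  The recursion is run on antiderivatives rather than on integrals (lemma
  \<open>ex_antiderivative_degenerate_power\<close>): the derivative of the boundary term changes sign, whereas
  the integrand itself is nonnegative, so passing to the half-line once, at the end, requires only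
  monotone convergence. For the same reason convergence needs no separate argument.

  The second form pulls one factor \<open>s\<close> out of each of the \<open>n + 1\<close> linear factors. The gamma
  identity then needs no change of variables: \<open>\<Gamma>\<^sub>\<mu>(n + 1)\<close> is the transform with parameter
  \<open>\<mu>\<close> of \<open>t ^ n\<close> at \<open>s = 1\<close>, and for \<open>\<mu> = \<lambda> / s\<close> the closed form evaluates it to
  \<open>n! / \<Prod>(1 - k \<lambda> / s)\<close>, which is \<open>s ^ (n + 1)\<close> times that form.
\<close>

text \<open>
  Since \<open>lam * t \<le> 1 + lam * t\<close>, the product is at most a constant times
  \<open>(1 + lam * t) powr (real m - q)\<close>.
\<close>
lemma tendsto_powr_times_power_0:
  fixes lam q :: real
  assumes "lam > 0" "q > real m"
  shows "((\<lambda>t. (1 + lam * t) powr (- q) * t ^ m) \<longlongrightarrow> 0) at_top"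
proof (rule tendsto_sandwich)
  show "\<forall>\<^sub>F t in at_top. 0 \<le> (1 + lam * t) powr (- q) * t ^ m"
    using eventually_ge_at_top[of 0] by eventually_elim simp
  show "\<forall>\<^sub>F t in at_top. (1 + lam * t) powr (- q) * t ^ m
          \<le> (1 + lam * t) powr (real m - q) / lam ^ m"
    using eventually_ge_at_top[of 0]
  proof eventually_elim
    case (elim t)
    have pos: "1 + lam * t > 0"
      using assms(1) elim by (simp add: add_pos_nonneg)
    have "(lam * t) ^ m \<le> (1 + lam * t) ^ m"
      using assms(1) elim by (intro power_mono) auto
    then have "t ^ m \<le> (1 + lam * t) ^ m / lam ^ m"
      using assms(1) by (simp add: field_simps)
    then have "(1 + lam * t) powr (- q) * t ^ m
        \<le> (1 + lam * t) powr (- q) * ((1 + lam * t) ^ m / lam ^ m)"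
      by (intro mult_left_mono) auto
    also have "\<dots> = (1 + lam * t) powr (real m - q) / lam ^ m"
      using pos by (simp add: powr_diff powr_minus powr_realpow field_simps)
    finally show ?case .
  qed
  have "((\<lambda>t. (1 + lam * t) powr (real m - q)) \<longlongrightarrow> 0) at_top"
  proof (rule tendsto_neg_powr)
    show "filterlim (\<lambda>t. 1 + lam * t) at_top at_top"
      using assms(1)
      by (intro filterlim_tendsto_add_at_top[OF tendsto_const]
          filterlim_tendsto_pos_mult_at_top[OF tendsto_const] filterlim_ident)
  qed (use assms(2) in simp)
  then show "((\<lambda>t. (1 + lam * t) powr (real m - q) / lam ^ m) \<longlongrightarrow> 0) at_top"
    by (rule tendsto_divide_zero)
qed simp

lemma has_field_derivative_one_plus_mult_powr:
  fixes lam s t :: real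
  assumes "lam > 0" "t \<ge> 0"
  shows "((\<lambda>t. (1 + lam * t) powr (1 - s / lam)) has_field_derivative
           (lam - s) * (1 + lam * t) powr (- (s / lam))) (at t)"
proof -
  have "1 + lam * t > 0"
    using assms by (simp add: add_pos_nonneg)
  moreover have "((\<lambda>t. 1 + lam * t) has_field_derivative lam) (at t)"
    by (auto intro!: derivative_eq_intros)
  ultimately have "((\<lambda>t. (1 + lam * t) powr (1 - s / lam)) has_field_derivative
      (1 - s / lam) * (1 + lam * t) powr (1 - s / lam - of_nat 1) * lam) (at t)"
    by (intro DERIV_fun_powr)
  then show ?thesis
    by (rule DERIV_cong) (use assms(1) in \<open>simp add: left_diff_distrib\<close>)
qed

text \<open>
  Write \<open>G n s\<close> for the antiderivative that vanishes at infinity; minus its value at \<open>0\<close> is the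
  integral over the half-line. Integration by parts reads
  \<open>(s - lam) G (n + 1) s t = (n + 1) G n (s - lam) t - (1 + lam t) powr (1 - s / lam) t ^ (n + 1)\<close>,
  and the last term vanishes both at infinity and at \<open>0\<close>.
\<close>
lemma ex_antiderivative_degenerate_power:
  fixes lam s :: real
  assumes "lam > 0" "s > (real n + 1) * lam"
  shows "\<exists>G. (\<forall>t\<ge>0. (G has_field_derivative (1 + lam * t) powr (- (s / lam)) * t ^ n) (at t))
           \<and> (G \<longlongrightarrow> 0) at_top \<and> G 0 = - (fact n / (\<Prod>k=1..n+1. s - real k * lam))"
  using assms(2)
proof (induction n arbitrary: s)
  case 0
  then have s: "s > lam"
    by simp
  define G where "G t = (1 + lam * t) powr (1 - s / lam) / (lam - s)" for t
  have "(G has_field_derivative (1 + lam * t) powr (- (s / lam)) * t ^ 0) (at t)" if "t \<ge> 0" for t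
    using DERIV_cdivide[OF has_field_derivative_one_plus_mult_powr[OF assms(1) that, of s],
        where c = "lam - s"] s
    unfolding G_def by simp
  moreover have "(G \<longlongrightarrow> 0) at_top"
  proof -
    have "real 0 < s / lam - 1"
      using s assms(1) by (simp add: field_simps)
    from tendsto_powr_times_power_0[OF assms(1) this]
    show ?thesis
      unfolding G_def by (intro tendsto_divide_zero) simp
  qed
  moreover have "G 0 = - (fact 0 / (\<Prod>k=1..0+1. s - real k * lam))"
    using s by (simp add: G_def field_simps)
  ultimately show ?case
    by blast
next
  case (Suc n)
  have s: "s > lam"
  proof -
    have "lam \<le> (real (Suc n) + 1) * lam"
      using assms(1) by simp
    then show ?thesis
      using Suc.prems by linarith
  qed
  have "s - lam > (real n + 1) * lam"
    using Suc.prems by (simp add: algebra_simps)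
  from Suc.IH[OF this] obtain H where
    H: "\<And>t. t \<ge> 0 \<Longrightarrow>
          (H has_field_derivative (1 + lam * t) powr (- ((s - lam) / lam)) * t ^ n) (at t)"
    and H_lim: "(H \<longlongrightarrow> 0) at_top"
    and H_0: "H 0 = - (fact n / (\<Prod>k=1..n+1. (s - lam) - real k * lam))"
    by blast
  have exponent: "- ((s - lam) / lam) = 1 - s / lam"
    using assms(1) by (simp add: field_simps)
  define G where
    "G t = (real (Suc n) * H t - (1 + lam * t) powr (1 - s / lam) * t ^ Suc n) / (s - lam)" for t
  have "(G has_field_derivative (1 + lam * t) powr (- (s / lam)) * t ^ Suc n) (at t)"
    if "t \<ge> 0" for t
  proof -
    have "((\<lambda>t. (1 + lam * t) powr (1 - s / lam) * t ^ Suc n) has_field_derivative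
        (lam - s) * (1 + lam * t) powr (- (s / lam)) * t ^ Suc n
        + (real (Suc n) * t ^ n) * (1 + lam * t) powr (1 - s / lam)) (at t)"
      using DERIV_mult[OF has_field_derivative_one_plus_mult_powr[OF assms(1) that, of s]
          DERIV_pow[of "Suc n"]]
      by simp
    from DERIV_cdivide[OF DERIV_diff[OF DERIV_cmult[OF H[OF that], of "real (Suc n)"] this],
        of "s - lam"]
    show ?thesis
      unfolding G_def
      by (rule DERIV_cong) (use s in \<open>simp add: exponent divide_simps, simp add: algebra_simps\<close>)
  qed
  moreover have "(G \<longlongrightarrow> 0) at_top"
  proof -
    have "real (Suc n) < s / lam - 1"
      using Suc.prems assms(1) by (simp add: field_simps)
    from tendsto_powr_times_power_0[OF assms(1) this]
    have "((\<lambda>t. (1 + lam * t) powr (1 - s / lam) * t ^ Suc n) \<longlongrightarrow> 0) at_top"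
      by simp
    from tendsto_diff[OF tendsto_mult_right_zero[OF H_lim, of "real (Suc n)"] this]
    show ?thesis
      unfolding G_def by (intro tendsto_divide_zero) simp
  qed
  moreover have "G 0 = - (fact (Suc n) / (\<Prod>k=1..Suc n + 1. s - real k * lam))"
  proof -
    have "(\<Prod>k=1..Suc n + 1. s - real k * lam)
        = (s - lam) * (\<Prod>k=Suc 1..Suc (n + 1). s - real k * lam)"
      by (subst prod.atLeast_Suc_atMost) auto
    also have "(\<Prod>k=Suc 1..Suc (n + 1). s - real k * lam)
        = (\<Prod>k=1..n+1. (s - lam) - real k * lam)"
      by (subst prod.shift_bounds_cl_Suc_ivl) (simp add: algebra_simps)
    finally show ?thesis
      by (simp add: G_def H_0)
  qed
  ultimately show ?case
    by blast
qed

lemma has_integral_degenerate_power: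
  fixes lam s :: real
  assumes "lam > 0" "s > (real n + 1) * lam"
  shows "((\<lambda>t. (1 + lam * t) powr (- (s / lam)) * t ^ n) has_integral
           fact n / (\<Prod>k=1..n+1. s - real k * lam)) {0..}"
    (is "(?h has_integral ?I) _")
proof -
  from ex_antiderivative_degenerate_power[OF assms] obtain G where
    G: "\<And>t. t \<ge> 0 \<Longrightarrow> (G has_field_derivative ?h t) (at t)"
    and G_lim: "(G \<longlongrightarrow> 0) at_top" and G_0: "G 0 = - ?I"
    by blast
  have FTC: "(?h has_integral G y - G 0) {0..y}" if "y \<ge> 0" for y
  proof (rule fundamental_theorem_of_calculus[OF that])
    fix t assume "t \<in> {0..y}"
    then show "(G has_vector_derivative ?h t) (at t within {0..y})"
      using G[of t]
      by (auto simp: has_real_derivative_iff_has_vector_derivative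
          intro: has_vector_derivative_at_within)
  qed
  show ?thesis
  proof (rule has_integral_to_inf)
    show "?h integrable_on {0..y}" for y
      using FTC[of y] by (cases "y \<ge> 0") (auto simp: integrable_on_def)
    have "((\<lambda>y. G y - G 0) \<longlongrightarrow> ?I) at_top"
      using tendsto_diff[OF G_lim tendsto_const[of "G 0"]] by (simp add: G_0)
    moreover have "\<forall>\<^sub>F y in at_top. G y - G 0 = integral {0..y} ?h"
      using eventually_ge_at_top[of 0] by eventually_elim (simp add: integral_unique[OF FTC])
    ultimately show "((\<lambda>y. integral {0..y} ?h) \<longlongrightarrow> ?I) at_top"
      by (rule Lim_transform_eventually)
  qed simp
qed

lemma degenerate_laplace_integrand_of_real:
  assumes "lam > 0" "t \<ge> 0"
  shows "degenerate_laplace_integrand lam (\<lambda>t. complex_of_real t ^ n) (complex_of_real s) t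
       = complex_of_real ((1 + lam * t) powr (- (s / lam)) * t ^ n)"
proof -
  have "complex_of_real (1 + lam * t) powr complex_of_real (- (s / lam))
      = complex_of_real ((1 + lam * t) powr (- (s / lam)))"
    using assms by (intro powr_of_real) simp
  then show ?thesis
    by (simp add: degenerate_laplace_integrand_def)
qed

lemma has_integral_degenerate_laplace_power:
  fixes lam s :: real
  assumes "lam > 0" "s > (real n + 1) * lam"
  shows "(degenerate_laplace_integrand lam (\<lambda>t. complex_of_real t ^ n) (complex_of_real s)
           has_integral complex_of_real (fact n / (\<Prod>k=1..n+1. s - real k * lam))) {0..}"
proof (rule has_integral_eq)
  show "((\<lambda>t. complex_of_real ((1 + lam * t) powr (- (s / lam)) * t ^ n)) has_integral
          complex_of_real (fact n / (\<Prod>k=1..n+1. s - real k * lam))) {0..}"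
    by (rule has_integral_of_real[OF has_integral_degenerate_power[OF assms]])
qed (simp only: degenerate_laplace_integrand_of_real[OF assms(1)] atLeast_iff)

text \<open>
  The integrands agree at every \<open>t \<ge> 0\<close>. At \<open>t = 0\<close> this uses \<open>n \<ge> 1\<close>, as \<open>0 powr 0 = 0\<close> whereas
  \<open>0 ^ 0 = 1\<close>.
\<close>
lemma degenerate_Gamma_of_nat_plus_1:
  assumes "\<mu> > 0" "n \<ge> 1"
  shows "degenerate_Gamma \<mu> (of_nat n + 1) = degenerate_laplace \<mu> (\<lambda>t. complex_of_real t ^ n) 1"
  unfolding degenerate_Gamma_def degenerate_laplace_def
proof (rule integral_cong)
  fix t :: real
  assume "t \<in> {0..}"
  then have t: "t \<ge> 0"
    by simp
  have "complex_of_real t powr (of_nat n) = complex_of_real t ^ n"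
    using assms(2) by (cases "t = 0") (auto simp: powr_nat)
  then show "complex_of_real ((1 + \<mu> * t) powr (- (1 / \<mu>)))
        * complex_of_real t powr (of_nat n + 1 - 1)
      = degenerate_laplace_integrand \<mu> (\<lambda>t. complex_of_real t ^ n) 1 t"
    using degenerate_laplace_integrand_of_real[OF assms(1) t, of n 1] by simp
qed

theorem theorem3p2:
  fixes lam s :: real and n :: nat
  assumes "lam > 0" and "n \<ge> 1" and "s > (real n + 1) * lam"
  shows "degenerate_laplace_converges lam (\<lambda>t. complex_of_real t ^ n) (complex_of_real s)
    \<and> degenerate_laplace lam (\<lambda>t. complex_of_real t ^ n) (complex_of_real s)
        = complex_of_real (fact n / (\<Prod>k=1..n+1. s - real k * lam))
    \<and> fact n / (\<Prod>k=1..n+1. s - real k * lam)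
        = fact n / s ^ (n + 1) * (1 / (\<Prod>k=1..n+1. 1 - real k * lam / s))
    \<and> degenerate_laplace lam (\<lambda>t. complex_of_real t ^ n) (complex_of_real s)
        = 1 / complex_of_real s ^ (n + 1) * degenerate_Gamma (lam / s) (of_nat n + 1)"
proof -
  have s: "s > 0"
  proof -
    have "(real n + 1) * lam > 0"
      using assms(1) by simp
    then show ?thesis
      using assms(3) by linarith
  qed
  note integral = has_integral_degenerate_laplace_power[OF assms(1,3)]
  have converges:
    "degenerate_laplace_converges lam (\<lambda>t. complex_of_real t ^ n) (complex_of_real s)"
    unfolding degenerate_laplace_converges_def by (rule has_integral_integrable[OF integral])
  have laplace: "degenerate_laplace lam (\<lambda>t. complex_of_real t ^ n) (complex_of_real s)
      = complex_of_real (fact n / (\<Prod>k=1..n+1. s - real k * lam))"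
    unfolding degenerate_laplace_def by (rule integral_unique[OF integral])
  have "(\<Prod>k=1..n+1. s - real k * lam) = (\<Prod>k=1..n+1. s * (1 - real k * lam / s))"
    using s by (intro prod.cong) (auto simp: field_simps)
  also have "\<dots> = s ^ (n + 1) * (\<Prod>k=1..n+1. 1 - real k * lam / s)"
    by (simp only: prod.distrib prod_constant card_atLeastAtMost) simp
  finally have factored: "fact n / (\<Prod>k=1..n+1. s - real k * lam)
      = fact n / s ^ (n + 1) * (1 / (\<Prod>k=1..n+1. 1 - real k * lam / s))"
    by simp
  have mu: "lam / s > 0" "1 > (real n + 1) * (lam / s)"
    using assms s by (simp_all add: field_simps)
  have "degenerate_Gamma (lam / s) (of_nat n + 1)
      = complex_of_real (fact n / (\<Prod>k=1..n+1. 1 - real k * (lam / s)))"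
    using integral_unique[OF has_integral_degenerate_laplace_power[OF mu]]
    by (simp only: degenerate_Gamma_of_nat_plus_1[OF mu(1) assms(2)] degenerate_laplace_def
        of_real_1)
  then have gamma: "1 / complex_of_real s ^ (n + 1) * degenerate_Gamma (lam / s) (of_nat n + 1)
      = complex_of_real (fact n / s ^ (n + 1) * (1 / (\<Prod>k=1..n+1. 1 - real k * lam / s)))"
    by simp
  show ?thesis
    by (intro conjI converges laplace factored) (simp only: laplace factored gamma)
qed

end
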